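(* Let $\mathcal{F}$ be a family of graphs with $K_n, \overline{K_m} \in \mathcal{F}$ for some $n,m\in\mathbb{N}$, and let $R\in\mathbb{N}$ be the minimal number such that no graph with at least $R$ vertices is $\mathcal{F}$-free. Let $D$ be a graph that is $\mathcal{F}$-free, satisfies $|D| = R-1$, and such that $\|D\|$ is minimal among all $\mathcal{F}$-free graphs with $R-1$ vertices. If $D$ has no isolated vertex, then any optimal online algorithm with advice for the Delayed $\mathcal{F}$-Node-Deletion Problem needs $\Omega(\log \mathrm{opt})$ bits of advice.
   Context: Graphs are finite, simple, undirected, with at least one vertex (the graph left after deletions may be empty); in particular $D$ is nonempty. $|G|$ and $\|G\|$ are the numbers of vertices and edges of $G$. $K_n$ is the complete graph on $n$ vertices and $\overline{K_m}$ the edgeless graph on $m$ vertices. $\log$ is base 2. A graph $G$ is $\mathcal{F}$-free if no $H\in\mathcal{F}$ is isomorphic to an induced subgraph of $G$. (The number $R$ exists by Ramsey's theorem.) Delayed $\mathcal{F}$-Node-Deletion Problem: $\mathcal{F}$ is a fixed nonempty finite family of graphs such that no member is isomorphic to an induced subgraph of another, distinct member. An instance is a graph $G$ with an ordering $v_1,\dots,v_N$ of its vertices. In step $i$, vertex $v_i$ and its adjacencies to $v_1,\dots,v_{i-1}$ are revealed, and the algorithm (not knowing the future vertices or $N$) must output $S_i\subseteq\{v_1,\dots,v_i\}$ such that $G[\{v_1,\dots,v_i\}]-S_i$ is $\mathcal{F}$-free; moreover $S_1\subseteq\dots\subseteq S_N$. The goal is to minimize $|S_N|$. For an instance, $\mathrm{opt}$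 is the minimum size of a set $S\subseteq V(G)$ with $G-S$ $\mathcal{F}$-free. An online algorithm with advice is deterministic, and additionally may sequentially read bits from an infinite binary tape. It is optimal if for every instance $I$ there is a tape content $\phi_I$ (chosen by an oracle knowing $I$) with which it outputs a solution of size $\mathrm{opt}(I)$ on $I$. "Any optimal online algorithm needs $\Omega(\log\mathrm{opt})$ bits of advice" means: there are $c>0$ and $k_0$, depending only on $\mathcal{F}$, such that for every optimal online algorithm with advice, every choice of such tape contents $\phi_I$, and every integer $k\ge k_0$, there is an instance $I$ with $\mathrm{opt}(I)=k$ on which the algorithm, run with $\phi_I$, reads at least $c\log k$ bits of the tape. *)

theory Defs
  imports Complex_Main
begin

datatype 'a graph = Graph (verts: "'a set") (edges: "'a set set")

text \<open>Graphs in the proper sense are nonempty; the operations below are also applied to empty graphs,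
  which can arise by deleting vertices.\<close>

definition is_graph :: "'a graph \<Rightarrow> bool" where
  "is_graph G \<longleftrightarrow> finite (verts G) \<and> verts G \<noteq> {} \<and> (\<forall>e\<in>edges G. e \<subseteq> verts G \<and> card e = 2)"

definition induced :: "'a graph \<Rightarrow> 'a set \<Rightarrow> 'a graph" where
  "induced G U = Graph (verts G \<inter> U) {e \<in> edges G. e \<subseteq> U}"

definition delete :: "'a graph \<Rightarrow> 'a set \<Rightarrow> 'a graph" where
  "delete G S = induced G (verts G - S)"

definition isomorphic :: "'a graph \<Rightarrow> 'b graph \<Rightarrow> bool" where
  "isomorphic G H \<longleftrightarrow>
     (\<exists>f. bij_betw f (verts G) (verts H) \<and>
          (\<forall>x\<in>verts G. \<forall>y\<in>verts G. {x, y} \<in> edges G \<longleftrightarrow> {f x, f y} \<in> edges H))"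

definition induced_in :: "'a graph \<Rightarrow> 'b graph \<Rightarrow> bool" where
  "induced_in H G \<longleftrightarrow> (\<exists>U\<subseteq>verts G. isomorphic H (induced G U))"

definition free :: "'a graph set \<Rightarrow> 'b graph \<Rightarrow> bool" where
  "free F G \<longleftrightarrow> (\<forall>H\<in>F. \<not> induced_in H G)"

definition complete_graph :: "nat \<Rightarrow> nat graph" where
  "complete_graph n = Graph {..<n} {e. e \<subseteq> {..<n} \<and> card e = 2}"

definition edgeless_graph :: "nat \<Rightarrow> nat graph" where
  "edgeless_graph m = Graph {..<m} {}"

definition isolated :: "'a graph \<Rightarrow> 'a \<Rightarrow> bool" where
  "isolated G v \<longleftrightarrow> v \<in> verts G \<and> (\<forall>e\<in>edges G. v \<notin> e)"

definition forbidden_family :: "'a graph set \<Rightarrow> bool" where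
  "forbidden_family F \<longleftrightarrow>
     finite F \<and> F \<noteq> {} \<and> (\<forall>H\<in>F. is_graph H) \<and>
     (\<forall>H\<in>F. \<forall>H'\<in>F. H \<noteq> H' \<longrightarrow> \<not> induced_in H H')"

text \<open>A graph together with the order in which its vertices are revealed. The first \<open>i\<close> steps
  reveal the instance \<open>prefix_inst i I\<close> (the first \<open>i\<close> vertices and the graph they induce).\<close>

type_synonym inst = "nat graph \<times> nat list"

definition is_inst :: "inst \<Rightarrow> bool" where
  "is_inst I \<longleftrightarrow> is_graph (fst I) \<and> distinct (snd I) \<and> set (snd I) = verts (fst I)"

definition prefix_inst :: "nat \<Rightarrow> inst \<Rightarrow> inst" where
  "prefix_inst i I = (induced (fst I) (set (take i (snd I))), take i (snd I))"

text \<open>The lists \<open>Ss\<close> below collect the outputs, so \<open>Ss ! i\<close> is the output of step \<open>i + 1\<close>.\<close>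

definition feasible :: "nat graph set \<Rightarrow> inst \<Rightarrow> nat set list \<Rightarrow> bool" where
  "feasible F I Ss \<longleftrightarrow>
     length Ss = length (snd I) \<and>
     (\<forall>i<length (snd I). Ss ! i \<subseteq> set (take (Suc i) (snd I)) \<and>
        free F (delete (fst (prefix_inst (Suc i) I)) (Ss ! i))) \<and>
     (\<forall>i. Suc i < length (snd I) \<longrightarrow> Ss ! i \<subseteq> Ss ! Suc i)"

definition opt :: "nat graph set \<Rightarrow> inst \<Rightarrow> nat" where
  "opt F I = (LEAST k. \<exists>S\<subseteq>verts (fst I). free F (delete (fst I) S) \<and> card S = k)"

text \<open>In every step a deterministic algorithm decides, from the part of the instance revealed so
  far and the advice bits read so far, whether to read the next bit of the tape or to output a set
  and end the step. Earlier decisions are determined by the same data, so there is no need for an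
  explicit internal state. No computability is required, and the behaviour on a tape is
  unconstrained unless the tape is the chosen advice for the instance.\<close>

datatype action = Read | Output "nat set"

type_synonym algorithm = "inst \<Rightarrow> bool list \<Rightarrow> action"

type_synonym tape = "nat \<Rightarrow> bool"

text \<open>\<open>run A \<phi> I w Ss\<close>: at some point of its computation on \<open>I\<close> with tape \<open>\<phi>\<close>, the algorithm has
  read exactly the bits \<open>w\<close> and completed \<open>length Ss\<close> steps with outputs \<open>Ss\<close>.\<close>

inductive run :: "algorithm \<Rightarrow> tape \<Rightarrow> inst \<Rightarrow> bool list \<Rightarrow> nat set list \<Rightarrow> bool"
  for A :: algorithm and \<phi> :: tape and I :: inst where
  run_start: "run A \<phi> I [] []"
| run_read: "run A \<phi> I w Ss \<Longrightarrow> length Ss < length (snd I) \<Longrightarrow>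
     A (prefix_inst (Suc (length Ss)) I) w = Read \<Longrightarrow> run A \<phi> I (w @ [\<phi> (length w)]) Ss"
| run_output: "run A \<phi> I w Ss \<Longrightarrow> length Ss < length (snd I) \<Longrightarrow>
     A (prefix_inst (Suc (length Ss)) I) w = Output S \<Longrightarrow> run A \<phi> I w (Ss @ [S])"

definition complete_run :: "algorithm \<Rightarrow> tape \<Rightarrow> inst \<Rightarrow> bool list \<Rightarrow> nat set list \<Rightarrow> bool" where
  "complete_run A \<phi> I w Ss \<longleftrightarrow> run A \<phi> I w Ss \<and> length Ss = length (snd I)"

definition solves_optimally :: "nat graph set \<Rightarrow> algorithm \<Rightarrow> tape \<Rightarrow> inst \<Rightarrow> bool" where
  "solves_optimally F A \<phi> I \<longleftrightarrow>
     (\<exists>w Ss. complete_run A \<phi> I w Ss \<and> feasible F I Ss \<and> card (last Ss) = opt F I)"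

definition optimal_algorithm :: "nat graph set \<Rightarrow> algorithm \<Rightarrow> bool" where
  "optimal_algorithm F A \<longleftrightarrow> (\<forall>I. is_inst I \<longrightarrow> (\<exists>\<phi>. solves_optimally F A \<phi> I))"

end

theory Submission
  imports Defs "HOL-Library.Ramsey"
begin

text \<open>Let \<open>v\<close> be a vertex of \<open>D\<close>. The adversary reveals \<open>k + 1\<close> pairwise nonadjacent vertices, and then
  completes one of them, \<open>j\<close>, to a copy of \<open>D\<close> in which \<open>j\<close> plays the role of \<open>v\<close>. The resulting
  graph has \<open>k + (R - 1)\<close> vertices, so an optimal solution keeps exactly \<open>R - 1\<close> vertices. A solution
  that deletes \<open>j\<close> would leave a free graph on \<open>R - 1\<close> vertices all of whose edges come from
  \<open>D - v\<close>; since \<open>v\<close> is not isolated, this contradicts the minimality of \<open>D\<close>. Hence \<open>j\<close> is among the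
  fewer than \<open>m\<close> independent vertices that the algorithm keeps before it can see \<open>j\<close>, and each advice
  string serves fewer than \<open>m\<close> of the \<open>k + 1\<close> choices of \<open>j\<close>.\<close>

section \<open>Induced subgraphs\<close>

text \<open>Explicit embeddings compose and can be exhibited directly, so the later arguments use
  this form. For \<open>x = y\<close> it compares the sets \<open>{x}\<close>, which are never edges
  of a proper graph.\<close>

lemma induced_in_iff:
  "induced_in H G \<longleftrightarrow> (\<exists>g. inj_on g (verts H) \<and> g ` verts H \<subseteq> verts G \<and>
     (\<forall>x\<in>verts H. \<forall>y\<in>verts H. {x, y} \<in> edges H \<longleftrightarrow> {g x, g y} \<in> edges G))"
proof
  assume "induced_in H G"
  then obtain U g where U: "U \<subseteq> verts G" and bij: "bij_betw g (verts H) (verts (induced G U))"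
    and e: "\<forall>x\<in>verts H. \<forall>y\<in>verts H. {x, y} \<in> edges H \<longleftrightarrow> {g x, g y} \<in> edges (induced G U)"
    unfolding induced_in_def isomorphic_def by blast
  have im: "g ` verts H = U"
    using bij U unfolding bij_betw_def induced_def by auto
  have "{g x, g y} \<in> edges (induced G U) \<longleftrightarrow> {g x, g y} \<in> edges G"
    if "x \<in> verts H" "y \<in> verts H" for x y
    using that im unfolding induced_def by auto
  then show "\<exists>g. inj_on g (verts H) \<and> g ` verts H \<subseteq> verts G \<and>
     (\<forall>x\<in>verts H. \<forall>y\<in>verts H. {x, y} \<in> edges H \<longleftrightarrow> {g x, g y} \<in> edges G)"
    using bij e im U by (intro exI[of _ g]) (auto simp: bij_betw_def)
next
  assume "\<exists>g. inj_on g (verts H) \<and> g ` verts H \<subseteq> verts G \<and>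
     (\<forall>x\<in>verts H. \<forall>y\<in>verts H. {x, y} \<in> edges H \<longleftrightarrow> {g x, g y} \<in> edges G)"
  then obtain g where "inj_on g (verts H)" "g ` verts H \<subseteq> verts G"
    "\<forall>x\<in>verts H. \<forall>y\<in>verts H. {x, y} \<in> edges H \<longleftrightarrow> {g x, g y} \<in> edges G" by blast
  then show "induced_in H G"
    unfolding induced_in_def isomorphic_def
    by (intro exI[of _ "g ` verts H"] conjI exI[of _ g]) (auto simp: bij_betw_def induced_def)
qed

lemma isomorphic_imp_induced_in: "isomorphic G H \<Longrightarrow> induced_in G H"
  unfolding induced_in_iff isomorphic_def bij_betw_def by fastforce

lemma induced_in_trans:
  assumes "induced_in G H" "induced_in H K"
  shows "induced_in G K"
proof -
  obtain g where g: "inj_on g (verts G)" "g ` verts G \<subseteq> verts H"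
    "\<forall>x\<in>verts G. \<forall>y\<in>verts G. {x, y} \<in> edges G \<longleftrightarrow> {g x, g y} \<in> edges H"
    using assms(1) unfolding induced_in_iff by blast
  obtain h where h: "inj_on h (verts H)" "h ` verts H \<subseteq> verts K"
    "\<forall>x\<in>verts H. \<forall>y\<in>verts H. {x, y} \<in> edges H \<longleftrightarrow> {h x, h y} \<in> edges K"
    using assms(2) unfolding induced_in_iff by blast
  have "inj_on (h \<circ> g) (verts G)"
    using g h by (meson comp_inj_on inj_on_subset)
  then show ?thesis
    unfolding induced_in_iff using g h by (intro exI[of _ "h \<circ> g"]) (auto simp: image_subset_iff)
qed

lemma free_induced_in: "free F G \<Longrightarrow> induced_in H G \<Longrightarrow> free F H"
  unfolding free_def using induced_in_trans by blast

lemma isomorphic_member_not_induced_in: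
  assumes "free F G" "H \<in> F" "isomorphic H K"
  shows "\<not> induced_in K G"
  using assms isomorphic_imp_induced_in induced_in_trans unfolding free_def by blast

lemma induced_in_edgeless_graph:
  assumes "finite V" "V \<subseteq> verts G" "m \<le> card V" "\<And>x y. x \<in> V \<Longrightarrow> y \<in> V \<Longrightarrow> {x, y} \<notin> edges G"
  shows "induced_in (edgeless_graph m) G"
proof -
  obtain g where "inj_on g {..<m}" "g ` {..<m} \<subseteq> V"
    using card_le_inj[of "{..<m}" V] assms by auto
  then show ?thesis
    unfolding induced_in_iff edgeless_graph_def using assms
    by (intro exI[of _ g]) (auto simp: image_subset_iff)
qed

lemma induced_in_complete_graph:
  assumes "is_graph G" "finite V" "V \<subseteq> verts G" "n \<le> card V"
    "\<And>x y. x \<in> V \<Longrightarrow> y \<in> V \<Longrightarrow> x \<noteq> y \<Longrightarrow> {x, y} \<in> edges G"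
  shows "induced_in (complete_graph n) G"
proof -
  obtain g where g: "inj_on g {..<n}" "g ` {..<n} \<subseteq> V"
    using card_le_inj[of "{..<n}" V] assms by auto
  have "{x, y} \<in> edges (complete_graph n) \<longleftrightarrow> {g x, g y} \<in> edges G" if "x < n" "y < n" for x y
  proof (cases "x = y")
    case True
    then show ?thesis
      using assms(1) unfolding is_graph_def complete_graph_def by auto
  next
    case False
    then have "g x \<noteq> g y" using g that by (auto dest: inj_onD)
    then show ?thesis
      using False assms(5) g that unfolding complete_graph_def by (auto simp: image_subset_iff)
  qed
  then show ?thesis
    unfolding induced_in_iff using g assms(3)
    by (intro exI[of _ g]) (auto simp: complete_graph_def)
qed

text \<open>Ramsey's theorem gives a clique of size \<open>n\<close> or an independent set of size
  \<open>m\<close> in every large graph, and both are forbidden. This is what makes the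
  \<open>LEAST\<close> defining \<open>R\<close> attained.\<close>

lemma free_graphs_bounded:
  fixes F :: "'a graph set"
  assumes "\<exists>H\<in>F. isomorphic H (complete_graph n)" "\<exists>H\<in>F. isomorphic H (edgeless_graph m)"
  shows "\<exists>r. \<forall>G :: 'b graph. is_graph G \<and> card (verts G) \<ge> r \<longrightarrow> \<not> free F G"
proof -
  obtain r where r: "\<And>(V :: 'b set) E. finite V \<Longrightarrow> card V \<ge> r \<Longrightarrow>
      \<exists>W\<subseteq>V. card W = n \<and> clique W E \<or> card W = m \<and> indep W E"
    using ramsey2[of n m] by metis
  have "\<not> free F G" if G: "is_graph G" "card (verts G) \<ge> r" for G :: "'b graph"
  proof
    assume free: "free F G"
    obtain W where W: "W \<subseteq> verts G"
      "card W = n \<and> clique W (edges G) \<or> card W = m \<and> indep W (edges G)"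
      using r[of "verts G" "edges G"] G unfolding is_graph_def by blast
    have fin: "finite W" using W(1) G(1) unfolding is_graph_def by (auto intro: finite_subset)
    from W(2) show False
    proof
      assume "card W = n \<and> clique W (edges G)"
      then have "induced_in (complete_graph n) G"
        using G(1) fin W(1) by (intro induced_in_complete_graph[of _ W]) (auto simp: clique_def)
      then show False using isomorphic_member_not_induced_in free assms(1) by blast
    next
      assume W': "card W = m \<and> indep W (edges G)"
      \<comment> \<open>The predicate \<open>indep\<close> speaks of distinct vertices only, so
        singleton edges are excluded separately.\<close>
      have "{x} \<notin> edges G" for x using G(1) unfolding is_graph_def by fastforce
      then have "induced_in (edgeless_graph m) G"
        using W' fin W(1)
        by (intro induced_in_edgeless_graph[of W]) (auto simp: indep_def, metis insert_absorb2)
      then show False using isomorphic_member_not_induced_in free assms(2) by blast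
    qed
  qed
  then show ?thesis by blast
qed

lemma is_graph_delete: "is_graph G \<Longrightarrow> \<not> verts G \<subseteq> S \<Longrightarrow> is_graph (delete G S)"
  unfolding is_graph_def delete_def induced_def by auto

section \<open>Runs\<close>

lemma run_tape: "run A \<phi> I w Ss \<Longrightarrow> i < length w \<Longrightarrow> w ! i = \<phi> i"
  by (induction rule: run.induct) (auto simp: nth_append less_Suc_eq)

lemma run_cong_tape:
  assumes "run A \<phi> I w Ss" "\<And>i. i < length w \<Longrightarrow> \<phi> i = \<psi> i"
  shows "run A \<psi> I w Ss"
  using assms
proof (induction rule: run.induct)
  case (run_read w Ss)
  then have "run A \<psi> I w Ss" by simp
  then have "run A \<psi> I (w @ [\<psi> (length w)]) Ss" using run_read.hyps by (intro run.run_read)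
  then show ?case using run_read.prems by simp
qed (auto intro: run.intros)

text \<open>Every action lengthens exactly one of \<open>w\<close> and \<open>Ss\<close> by one, so
  \<open>length w + length Ss\<close> counts actions. Since the algorithm is deterministic, this
  count determines the configuration.\<close>

lemma run_unique:
  assumes "run A \<phi> I w Ss" "run A \<phi> I w' Ss'" "length w + length Ss = length w' + length Ss'"
  shows "w = w' \<and> Ss = Ss'"
  using assms
proof (induction arbitrary: w' Ss' rule: run.induct)
  case run_start
  then show ?case by simp
next
  case (run_read w Ss)
  from run_read.prems show ?case
    by (cases rule: run.cases) (use run_read.hyps run_read.IH in fastforce)+
next
  case (run_output w Ss S)
  from run_output.prems show ?case
    by (cases rule: run.cases) (use run_output.hyps run_output.IH in fastforce)+
qed

lemma run_intermediate:
  assumes "run A \<phi> I w Ss" "l < length w + length Ss"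
  shows "\<exists>w' Ss'. run A \<phi> I w' Ss' \<and> length w' + length Ss' = l \<and> length Ss' < length (snd I)"
  using assms by (induction rule: run.induct) (fastforce simp: less_Suc_eq)+

text \<open>If one complete run took more actions, it would pass, before finishing its last step,
  through a configuration with the action count of the other. By \<open>run_unique\<close> that
  configuration is the finished one, a contradiction.\<close>

lemma complete_run_unique:
  assumes "complete_run A \<phi> I w Ss" "complete_run A \<phi> I w' Ss'"
  shows "w = w' \<and> Ss = Ss'"
proof -
  have not_less: "\<not> length u + length Ts < length u' + length Ts'"
    if c: "complete_run A \<phi> I u Ts" "complete_run A \<phi> I u' Ts'" for u u' Ts Ts'
  proof
    assume "length u + length Ts < length u' + length Ts'"
    then obtain x Xs where "run A \<phi> I x Xs" "length x + length Xs = length u + length Ts"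
      "length Xs < length (snd I)"
      using c run_intermediate unfolding complete_run_def by blast
    then show False using c(1) run_unique[of A \<phi> I x Xs u Ts] unfolding complete_run_def by auto
  qed
  have "length w + length Ss = length w' + length Ss'"
    using not_less[OF assms] not_less[OF assms(2,1)] by simp
  then show ?thesis using assms run_unique unfolding complete_run_def by blast
qed

section \<open>Restricting runs to a prefix of the instance\<close>

lemma prefix_inst_prefix_inst:
  assumes "i \<le> p"
  shows "prefix_inst i (prefix_inst p I) = prefix_inst i I"
  using set_take_subset_set_take[OF assms, of "snd I"] assms
  unfolding prefix_inst_def induced_def by (auto simp: min_def)

lemma prefix_inst_length: "is_inst I \<Longrightarrow> prefix_inst (length (snd I)) I = I"
  by (cases I, cases "fst I") (auto simp: prefix_inst_def is_inst_def is_graph_def induced_def)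

text \<open>While step \<open>p\<close> is unfinished, the algorithm sees nothing beyond the first
  \<open>p\<close> vertices. The inequality \<open>length Ss < p\<close> is strict because after
  \<open>p\<close> outputs a run on \<open>I\<close> may still read bits in step
  \<open>p + 1\<close>, whereas the truncated instance has ended.\<close>

lemma run_prefix_inst:
  assumes "run A \<phi> I w Ss" "length Ss < p" "p \<le> length (snd I)"
  shows "run A \<phi> (prefix_inst p I) w Ss"
proof -
  have len: "length (snd (prefix_inst p I)) = p" using assms(3) by (simp add: prefix_inst_def)
  from assms(1,2) show ?thesis
    by (induction rule: run.induct) (auto intro!: run.intros simp: prefix_inst_prefix_inst len)
qed

text \<open>The string \<open>w'\<close> may be shorter than \<open>w\<close>: it omits the bits
  read after the output of step \<open>p\<close>.\<close>

lemma complete_run_prefix_inst: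
  assumes "run A \<phi> I w Ss" "p \<le> length Ss" "p \<le> length (snd I)"
  shows "\<exists>w'. complete_run A \<phi> (prefix_inst p I) w' (take p Ss)"
  using assms
proof (induction rule: run.induct)
  case run_start
  then show ?case
    by (auto simp: complete_run_def prefix_inst_def intro: run.intros)
next
  case (run_read w Ss)
  then show ?case by simp
next
  case (run_output w Ss S)
  show ?case
  proof (cases "p \<le> length Ss")
    case True
    then show ?thesis using run_output by simp
  next
    case False
    then have p: "p = Suc (length Ss)" using run_output by simp
    have "run A \<phi> (prefix_inst p I) w Ss"
      using run_prefix_inst run_output p by auto
    then have "run A \<phi> (prefix_inst p I) w (Ss @ [S])"
      using run_output.hyps run_output.prems p
      by (intro run.run_output) (auto simp: prefix_inst_prefix_inst, simp add: prefix_inst_def)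
    then show ?thesis
      using p run_output.prems by (auto simp: complete_run_def prefix_inst_def)
  qed
qed

text \<open>The two tapes may differ beyond the bits that are read.\<close>

lemma run_take_cong:
  assumes "run A \<phi> I w Ss" "run A \<psi> J w Ts" "prefix_inst p I = prefix_inst p J"
    "p \<le> length Ss" "p \<le> length (snd I)" "p \<le> length Ts" "p \<le> length (snd J)"
  shows "take p Ss = take p Ts"
proof -
  \<comment> \<open>Both tapes are replaced by the common tape \<open>(!) w\<close>. Its values
    beyond \<open>length w\<close> are unspecified but the same for both runs, so uniqueness applies
    on the common prefix instance.\<close>
  have "run A ((!) w) I w Ss" "run A ((!) w) J w Ts"
    using run_cong_tape run_tape assms(1,2) by metis+
  then show ?thesis
    using complete_run_prefix_inst complete_run_unique assms(3-) by metis
qed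

lemma feasible_last:
  assumes "feasible F I Ss" "i < length Ss"
  shows "Ss ! i \<subseteq> last Ss"
proof -
  have "l < length Ss \<Longrightarrow> Ss ! i \<subseteq> Ss ! l" if "i \<le> l" for l
    using that
  proof (induction l rule: dec_induct)
    case (step l)
    have "Ss ! l \<subseteq> Ss ! Suc l" using assms(1) step.prems unfolding feasible_def by simp
    then show ?case using step by auto
  qed simp
  from this[of "length Ss - 1"] show ?thesis using assms(2) by (cases "Ss = []") (simp_all add: last_conv_nth)
qed

section \<open>The hard instances\<close>

text \<open>The shift by \<open>Suc k\<close> moves the other vertices of \<open>D\<close> above the
  initial vertices \<open>0\<close> to \<open>k\<close>. For \<open>j \<le> k\<close> the map is
  injective on all of \<open>nat\<close>, so its inverse is available without restricting the
  domain.\<close>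

definition place :: "nat \<Rightarrow> nat \<Rightarrow> nat \<Rightarrow> nat \<Rightarrow> nat" where
  "place v k j x = (if x = v then j else x + Suc k)"

text \<open>For \<open>v \<in> verts D\<close> and \<open>j \<le> k\<close> this is \<open>D\<close>
  together with \<open>k\<close> isolated vertices; only the name of the copy of \<open>v\<close>
  depends on \<open>j\<close>.\<close>

definition hard_graph :: "nat graph \<Rightarrow> nat \<Rightarrow> nat \<Rightarrow> nat \<Rightarrow> nat graph" where
  "hard_graph D v k j =
     Graph ({..k} \<union> (\<lambda>x. x + Suc k) ` (verts D - {v})) ((`) (place v k j) ` edges D)"

definition hard_inst :: "nat graph \<Rightarrow> nat \<Rightarrow> nat \<Rightarrow> nat \<Rightarrow> inst" where
  "hard_inst D v k j = (hard_graph D v k j,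
     [0..<Suc k] @ sorted_list_of_set ((\<lambda>x. x + Suc k) ` (verts D - {v})))"

lemma inj_place: "j \<le> k \<Longrightarrow> inj (place v k j)"
  by (auto simp: inj_def place_def)

lemma place_image_verts:
  "v \<in> verts D \<Longrightarrow> place v k j ` verts D = insert j ((\<lambda>x. x + Suc k) ` (verts D - {v}))"
  by (auto simp: place_def image_def)

lemma is_graph_hard_graph:
  assumes "is_graph D" "v \<in> verts D" "j \<le> k"
  shows "is_graph (hard_graph D v k j)"
proof -
  have "place v k j ` e \<subseteq> verts (hard_graph D v k j) \<and> card (place v k j ` e) = 2" if "e \<in> edges D" for e
  proof
    have "e \<subseteq> verts D" "card e = 2" using that assms(1) unfolding is_graph_def by auto
    then show "card (place v k j ` e) = 2"
      using card_image inj_place[OF assms(3)] inj_on_subset by (metis subset_UNIV)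
    show "place v k j ` e \<subseteq> verts (hard_graph D v k j)"
      using image_mono[OF \<open>e \<subseteq> verts D\<close>, of "place v k j"] place_image_verts[OF assms(2), of k j] assms(3)
      unfolding hard_graph_def by auto
  qed
  then show ?thesis
    using assms(1) unfolding is_graph_def by (auto simp: hard_graph_def)
qed

lemma is_inst_hard_inst:
  assumes "is_graph D" "v \<in> verts D" "j \<le> k"
  shows "is_inst (hard_inst D v k j)"
proof -
  have "finite (verts D)" using assms(1) by (simp add: is_graph_def)
  then show ?thesis
    using is_graph_hard_graph[OF assms] unfolding is_inst_def hard_inst_def
    by (auto simp: hard_graph_def)
qed

lemma card_verts_hard_graph:
  assumes "is_graph D" "v \<in> verts D"
  shows "card (verts (hard_graph D v k j)) = k + card (verts D)"
proof -
  have fin: "finite (verts D)" using assms(1) by (simp add: is_graph_def)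
  then have "card (verts (hard_graph D v k j)) = Suc k + card (verts D - {v})"
    unfolding hard_graph_def graph.sel
    by (subst card_Un_disjoint) (auto simp: card_image inj_on_def)
  then show ?thesis
    using fin assms(2) by (simp add: card_Diff_singleton card_gt_0_iff)
      (metis Suc_pred card_gt_0_iff empty_iff)
qed

text \<open>An edge of \<open>D\<close> has an endpoint other than \<open>v\<close>, and
  \<open>place\<close> sends that endpoint above \<open>k\<close>.\<close>

lemma hard_graph_edge_not_initial:
  assumes "is_graph D" "e \<in> edges (hard_graph D v k j)"
  shows "\<not> e \<subseteq> {..k}"
proof -
  obtain d where d: "d \<in> edges D" "e = place v k j ` d" using assms(2) by (auto simp: hard_graph_def)
  have "card d = 2" using assms(1) d by (auto simp: is_graph_def)
  then obtain x where "x \<in> d" "x \<noteq> v" by (metis card_2_iff insertI1 insert_commute)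
  then show ?thesis using d by (force simp: place_def)
qed

lemma take_hard_inst: "take (Suc k) (snd (hard_inst D v k j)) = [0..<Suc k]"
  by (simp add: hard_inst_def)

lemma set_upt_Suc: "set [0..<Suc k] = {..k}"
  by auto

text \<open>The right-hand side does not mention \<open>j\<close>: the first \<open>Suc k\<close>
  steps reveal nothing about the choice of \<open>j\<close>.\<close>

lemma prefix_inst_hard_inst:
  assumes "is_graph D"
  shows "prefix_inst (Suc k) (hard_inst D v k j) = (Graph {..k} {}, [0..<Suc k])"
proof -
  have "{e \<in> edges (hard_graph D v k j). e \<subseteq> {..k}} = {}"
    using hard_graph_edge_not_initial[OF assms] by blast
  moreover have "verts (hard_graph D v k j) \<inter> {..k} = {..k}" by (auto simp: hard_graph_def)
  ultimately show ?thesis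
    unfolding prefix_inst_def take_hard_inst set_upt_Suc by (simp add: induced_def hard_inst_def)
qed

text \<open>The remaining graph is the copy of \<open>D\<close>, embedded into \<open>D\<close> by
  the inverse of \<open>place\<close>. This direction is the one that transfers freeness from
  \<open>D\<close>.\<close>

lemma hard_graph_contains:
  assumes "is_graph D" "v \<in> verts D" "j \<le> k"
  shows "induced_in (delete (hard_graph D v k j) ({..k} - {j})) D"
proof -
  let ?f = "place v k j" and ?G = "delete (hard_graph D v k j) ({..k} - {j})"
  have inj: "inj ?f" using inj_place assms(3) .
  have V: "verts ?G = ?f ` verts D"
    unfolding place_image_verts[OF assms(2)]
    using assms(3) by (auto simp: delete_def induced_def hard_graph_def)
  have E: "edges ?G = (`) ?f ` edges D"
  proof -
    have "?f ` e \<subseteq> verts (hard_graph D v k j) - ({..k} - {j})" if "e \<in> edges D" for e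
    proof -
      have "?f ` e \<subseteq> ?f ` verts D" using that assms(1) unfolding is_graph_def by blast
      then show ?thesis using V by (auto simp: delete_def induced_def)
    qed
    then show ?thesis by (auto simp: delete_def induced_def) (auto simp: hard_graph_def)
  qed
  have mem: "{x, y} \<in> edges D \<longleftrightarrow> {?f x, ?f y} \<in> edges ?G" for x y
  proof -
    have "inj ((`) ?f)" using inj by (simp add: inj_def inj_image_eq_iff)
    moreover have "{?f x, ?f y} = ?f ` {x, y}" by simp
    ultimately show ?thesis unfolding E by (simp only: inj_image_mem_iff)
  qed
  show ?thesis
    unfolding induced_in_iff V
    by (intro exI[of _ "inv ?f"] conjI ballI)
       (auto simp: inv_f_f[OF inj] inj_on_def mem)
qed

text \<open>Deleting all initial vertices except \<open>j\<close> costs \<open>k\<close>.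
  Conversely, at most \<open>card (verts D)\<close> of the \<open>k + card (verts D)\<close>
  vertices can remain.\<close>

lemma opt_hard_inst:
  assumes "is_graph D" "v \<in> verts D" "j \<le> k" "free F D"
    and max: "\<And>G :: nat graph. is_graph G \<Longrightarrow> free F G \<Longrightarrow> card (verts G) \<le> card (verts D)"
  shows "opt F (hard_inst D v k j) = k"
proof -
  let ?G = "hard_graph D v k j"
  have G: "is_graph ?G" using is_graph_hard_graph assms(1-3) .
  then have fin: "finite (verts ?G)" by (simp add: is_graph_def)
  have "\<exists>S\<subseteq>verts ?G. free F (delete ?G S) \<and> card S = k"
  proof (intro exI[of _ "{..k} - {j}"] conjI)
    show "free F (delete ?G ({..k} - {j}))"
      using free_induced_in hard_graph_contains assms(1-4) by blast
    show "{..k} - {j} \<subseteq> verts ?G" by (auto simp: hard_graph_def)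
    show "card ({..k} - {j}) = k" using assms(3) by simp
  qed
  moreover have "k \<le> card S" if S: "S \<subseteq> verts ?G" "free F (delete ?G S)" for S
  proof -
    have V: "verts (delete ?G S) = verts ?G - S" by (auto simp: delete_def induced_def)
    \<comment> \<open>The bound \<open>max\<close> speaks of nonempty graphs only, so the case where
      every vertex is deleted is treated separately.\<close>
    have "card (verts ?G - S) \<le> card (verts D)"
    proof (cases "verts ?G \<subseteq> S")
      case True
      then have "card (verts ?G - S) = 0" by (simp only: Diff_eq_empty_iff[THEN iffD2] card.empty)
      then show ?thesis by simp
    next
      case False
      show ?thesis using max[OF is_graph_delete[OF G False] S(2)] unfolding V .
    qed
    then show ?thesis
      using S fin card_verts_hard_graph[OF assms(1,2), of k j]
      by (simp add: card_Diff_subset finite_subset)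
  qed
  ultimately show ?thesis
    unfolding opt_def hard_inst_def fst_conv by (intro Least_equality) blast+
qed

lemma optimal_keeps_connected_vertex:
  assumes "is_graph D" "v \<in> verts D" "j \<le> k" "\<not> isolated D v"
    and min: "\<And>G :: nat graph. is_graph G \<Longrightarrow> free F G \<Longrightarrow> card (verts G) = card (verts D) \<Longrightarrow>
      card (edges D) \<le> card (edges G)"
    and S: "S \<subseteq> verts (hard_graph D v k j)" "free F (delete (hard_graph D v k j) S)" "card S = k"
  shows "j \<notin> S"
proof
  assume "j \<in> S"
  let ?G = "hard_graph D v k j" and ?D' = "{e \<in> edges D. v \<notin> e}"
  have G: "is_graph ?G" using is_graph_hard_graph assms(1-3) .
  then have fin: "finite (verts ?G)" by (simp add: is_graph_def)
  have V: "verts (delete ?G S) = verts ?G - S" by (auto simp: delete_def induced_def)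
  have card: "card (verts (delete ?G S)) = card (verts D)"
    unfolding V using S fin card_verts_hard_graph[OF assms(1,2), of k j]
    by (simp add: card_Diff_subset finite_subset)
  have "card (verts D) > 0" using assms(1) by (auto simp: is_graph_def card_gt_0_iff)
  then have "verts ?G - S \<noteq> {}" using card V by (metis card.empty less_nat_zero_code)
  then have "is_graph (delete ?G S)" using is_graph_delete[OF G] by blast
  then have le: "card (edges D) \<le> card (edges (delete ?G S))" using min S(2) card by blast
  have "edges D \<subseteq> Pow (verts D)" using assms(1) by (auto simp: is_graph_def)
  then have finD: "finite (edges D)" using assms(1) finite_subset by (auto simp: is_graph_def)
  \<comment> \<open>The copy of an edge through \<open>v\<close> contains the deleted vertex
    \<open>j\<close>, so only copies of edges avoiding \<open>v\<close> can survive.\<close>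
  have "edges (delete ?G S) \<subseteq> (`) (place v k j) ` ?D'"
    using \<open>j \<in> S\<close> by (auto simp: delete_def induced_def hard_graph_def place_def)
  then have "card (edges (delete ?G S)) \<le> card ?D'"
    using finD by (simp add: surj_card_le)
  moreover have "card ?D' < card (edges D)"
    using finD assms(2,4) by (intro psubset_card_mono) (auto simp: isolated_def)
  ultimately show False using le by simp
qed

text \<open>\<open>Ss ! k\<close> is the output of step \<open>k + 1\<close>, when exactly the
  \<open>k + 1\<close> independent vertices have been revealed. Keeping \<open>m\<close> of them
  would leave a forbidden edgeless graph.\<close>

lemma card_initially_kept:
  assumes "is_graph D" "feasible F (hard_inst D v k j) Ss" "\<exists>H\<in>F. isomorphic H (edgeless_graph m)"
  shows "card ({..k} - Ss ! k) < m"
proof (rule ccontr)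
  assume "\<not> card ({..k} - Ss ! k) < m"
  let ?G = "delete (Graph {..k} {}) (Ss ! k)"
  have "k < length (snd (hard_inst D v k j))" by (simp add: hard_inst_def)
  then have "free F ?G"
    using assms(2) prefix_inst_hard_inst[OF assms(1), of k v j] unfolding feasible_def by fastforce
  moreover have "induced_in (edgeless_graph m) ?G"
    using \<open>\<not> _\<close> by (intro induced_in_edgeless_graph[of "{..k} - Ss ! k"]) (auto simp: delete_def induced_def)
  ultimately show False using isomorphic_member_not_induced_in assms(3) by blast
qed

section \<open>Counting advice strings\<close>

lemma card_bool_lists_length_le: "card {w :: bool list. length w \<le> b} < 2 * 2 ^ b"
proof -
  have "card {w :: bool list. length w \<le> b} = (\<Sum>i\<le>b. 2 ^ i)"
    using card_lists_length_le[of "UNIV :: bool set" b] by simp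
  moreover have "(\<Sum>i\<le>b. 2 ^ i) < 2 * (2 ^ b :: nat)" by (induction b) auto
  ultimately show ?thesis by simp
qed

text \<open>Pigeonhole: if all lengths are at most \<open>b\<close> with \<open>4 ^ b < k\<close>,
  there are fewer than \<open>2 * 2 ^ b\<close> strings, each used at most \<open>m\<close> times,
  so \<open>k < 2 * 2 ^ b * m\<close>. Squaring gives
  \<open>k ^ 2 \<le> 4 ^ b * (4 * m ^ 2)\<close>, which is impossible once
  \<open>k > 4 * m ^ 2\<close>.\<close>

lemma long_string_exists:
  fixes w :: "nat \<Rightarrow> bool list"
  assumes fiber: "\<And>j. j \<le> k \<Longrightarrow> card {i. i \<le> k \<and> w i = w j} \<le> m" and k: "k \<ge> 4 * m ^ 2 + 1"
  shows "\<exists>j\<le>k. real (length (w j)) \<ge> 1/2 * log 2 (real k)"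
proof (rule ccontr)
  assume "\<not> ?thesis"
  then have short: "real (length (w j)) < 1/2 * log 2 (real k)" if "j \<le> k" for j
    using that by (meson not_le)
  define b where "b = Max ((length \<circ> w) ` {..k})"
  have "b \<in> (length \<circ> w) ` {..k}" unfolding b_def by (intro Max_in) auto
  then have "2 * real b < log 2 (real k)" using short by fastforce
  then have "2 powr (2 * real b) < real k" using k by (simp add: less_log_iff)
  moreover have "2 powr (2 * real b) = real ((2 ^ b) ^ 2)"
    by (simp add: powr_realpow[symmetric] powr_powr mult.commute)
  ultimately have b: "(2 ^ b) ^ 2 < k" by (simp only: of_nat_less_iff)
  have "w ` {..k} \<subseteq> {w. length w \<le> b}" unfolding b_def by (auto intro: Max_ge)
  then have "card (w ` {..k}) \<le> card {w :: bool list. length w \<le> b}"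
    using finite_lists_length_le[of "UNIV :: bool set" b] by (intro card_mono) auto
  also note card_bool_lists_length_le
  finally have W: "card (w ` {..k}) \<le> 2 * 2 ^ b" by simp
  have "{..k} = (\<Union>u\<in>w ` {..k}. {i. i \<le> k \<and> w i = u})" by auto
  then have "Suc k \<le> (\<Sum>u\<in>w ` {..k}. card {i. i \<le> k \<and> w i = u})"
    by (metis card_UN_le card_atMost finite_atMost finite_imageI)
  also have "\<dots> \<le> card (w ` {..k}) * m"
    using sum_bounded_above[of "w ` {..k}" "\<lambda>u. card {i. i \<le> k \<and> w i = u}" m] fiber by auto
  also have "\<dots> \<le> 2 * 2 ^ b * m" using W by (rule mult_le_mono1)
  \<comment> \<open>Squaring turns \<open>2 ^ b\<close> into \<open>(2 ^ b) ^ 2\<close>, the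
    quantity bounded by \<open>k\<close>; the factor \<open>1/2\<close> before the logarithm was
    chosen for this.\<close>
  finally have "k ^ 2 \<le> (2 * 2 ^ b * m) ^ 2" by (intro power_mono) auto
  also have "\<dots> = (2 ^ b) ^ 2 * (4 * m ^ 2)" by (simp add: power_mult_distrib)
  also have "\<dots> \<le> k * (4 * m ^ 2)" using b by (intro mult_le_mono1) simp
  also have "\<dots> < k * k" using k by (intro mult_strict_left_mono) auto
  finally show False by (simp add: power2_eq_square)
qed

section \<open>The adversary argument against an arbitrary optimal algorithm\<close>

theorem theorem8:
  fixes F :: "nat graph set" and D :: "nat graph" and n m R :: nat
  assumes "forbidden_family F"
    and "\<exists>H\<in>F. isomorphic H (complete_graph n)"
    and "\<exists>H\<in>F. isomorphic H (edgeless_graph m)"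
    and "R = (LEAST r. \<forall>G :: nat graph. is_graph G \<and> card (verts G) \<ge> r \<longrightarrow> \<not> free F G)"
    and "is_graph D" and "free F D" and "card (verts D) = R - 1"
    and "\<And>D' :: nat graph. is_graph D' \<Longrightarrow> free F D' \<Longrightarrow> card (verts D') = R - 1 \<Longrightarrow>
           card (edges D) \<le> card (edges D')"
    and "\<not> (\<exists>v. isolated D v)"
  shows "\<exists>c::real>0. \<exists>k0::nat. \<forall>A. optimal_algorithm F A \<longrightarrow>
     (\<forall>\<phi> :: inst \<Rightarrow> tape. (\<forall>I. is_inst I \<longrightarrow> solves_optimally F A (\<phi> I) I) \<longrightarrow>
       (\<forall>k\<ge>k0. \<exists>I. is_inst I \<and> opt F I = k \<and>
          (\<exists>w Ss. complete_run A (\<phi> I) I w Ss \<and> real (length w) \<ge> c * log 2 (real k))))"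
proof -
  have "\<forall>G :: nat graph. is_graph G \<and> card (verts G) \<ge> R \<longrightarrow> \<not> free F G"
    unfolding assms(4) by (rule LeastI_ex) (rule free_graphs_bounded[OF assms(2,3)])
  then have "card (verts G) < R" if "is_graph G" "free F G" for G :: "nat graph"
    using that by (meson not_le)
  \<comment> \<open>Since \<open>card (verts D) = R - 1\<close>, the graph \<open>D\<close> has the
    largest order of any free graph.\<close>
  then have max: "card (verts G) \<le> card (verts D)" if "is_graph G" "free F G" for G :: "nat graph"
    using that assms(7) by fastforce
  have min: "card (edges D) \<le> card (edges G)"
    if "is_graph G" "free F G" "card (verts G) = card (verts D)" for G :: "nat graph"
    using that assms(7,8) by simp
  obtain v where v: "v \<in> verts D" using assms(5) by (auto simp: is_graph_def)
  have hard: "\<exists>I. is_inst I \<and> opt F I = k \<and>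
      (\<exists>w Ss. complete_run A (\<phi> I) I w Ss \<and> real (length w) \<ge> 1/2 * log 2 (real k))"
    if solves: "\<forall>I. is_inst I \<longrightarrow> solves_optimally F A (\<phi> I) I" and k: "k \<ge> 4 * m ^ 2 + 1"
    for A and \<phi> :: "inst \<Rightarrow> tape" and k
  proof -
    let ?I = "hard_inst D v k"
    have inst: "is_inst (?I j)" and opt: "opt F (?I j) = k" if "j \<le> k" for j
      using is_inst_hard_inst opt_hard_inst assms(5,6) v max that by blast+
    \<comment> \<open>The condition \<open>j \<le> k\<close> stands inside the existential
      quantifiers so that \<open>w\<close> and \<open>Ss\<close> can be chosen as functions of
      \<open>j\<close>.\<close>
    have "\<forall>j. \<exists>w Ss. j \<le> k \<longrightarrow>
        complete_run A (\<phi> (?I j)) (?I j) w Ss \<and> feasible F (?I j) Ss \<and> card (last Ss) = k"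
      using solves inst opt unfolding solves_optimally_def by metis
    then obtain w Ss where run: "complete_run A (\<phi> (?I j)) (?I j) (w j) (Ss j)"
      and feas: "feasible F (?I j) (Ss j)" and card: "card (last (Ss j)) = k" if "j \<le> k" for j
      by metis
    have len: "k < length (snd (?I j))" for j by (simp add: hard_inst_def)
    have len_Ss: "length (Ss j) = length (snd (?I j))" if "j \<le> k" for j
      using run[OF that] by (simp add: complete_run_def)
    \<comment> \<open>The final solution keeps \<open>j\<close> by minimality of \<open>D\<close>.
      Deletions are never revoked, so \<open>j\<close> is already kept after step
      \<open>k + 1\<close>.\<close>
    have kept: "j \<notin> Ss j ! k" if j: "j \<le> k" for j
    proof -
      let ?l = "length (snd (?I j)) - 1"
      have l: "?l < length (snd (?I j))" "Suc ?l = length (snd (?I j))" using len[of j] by linarith+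
      have last: "last (Ss j) = Ss j ! ?l"
        using l len_Ss[OF j] by (metis last_conv_nth length_0_conv less_nat_zero_code)
      have "last (Ss j) \<subseteq> set (take (Suc ?l) (snd (?I j)))"
        and free: "free F (delete (fst (prefix_inst (Suc ?l) (?I j))) (last (Ss j)))"
        using feas[OF j] l(1) unfolding feasible_def last by blast+
      then have "last (Ss j) \<subseteq> verts (hard_graph D v k j)"
        using inst[OF j] unfolding l(2) is_inst_def by (simp add: hard_inst_def)
      moreover have "free F (delete (hard_graph D v k j) (last (Ss j)))"
        using free unfolding l(2) prefix_inst_length[OF inst[OF j]] by (simp add: hard_inst_def)
      ultimately have "j \<notin> last (Ss j)"
        using optimal_keeps_connected_vertex assms(5,9) v j min card by metis
      then show ?thesis using feasible_last[OF feas[OF j]] len_Ss[OF j] len by auto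
    qed
    \<comment> \<open>The first \<open>k + 1\<close> steps see the same instance for
      \<open>i\<close> and \<open>j\<close>; with the same bits read, their outputs coincide,
      including the one at index \<open>k\<close>.\<close>
    have same: "Ss i ! k = Ss j ! k" if "i \<le> k" "j \<le> k" "w i = w j" for i j
    proof -
      have "take (Suc k) (Ss i) = take (Suc k) (Ss j)"
        using run[OF that(1)] run[OF that(2)] that(3) prefix_inst_hard_inst[OF assms(5)] len
        by (intro run_take_cong[of A "\<phi> (?I i)" "?I i" "w i" _ "\<phi> (?I j)" "?I j"])
          (auto simp: complete_run_def Suc_le_eq)
      then show ?thesis by (metis lessI nth_take)
    qed
    have "card {i. i \<le> k \<and> w i = w j} \<le> m" if "j \<le> k" for j
    proof -
      \<comment> \<open>All \<open>i\<close> sharing the string of \<open>j\<close> share its output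
        at index \<open>k\<close>, and that output must spare each of them.\<close>
      have "{i. i \<le> k \<and> w i = w j} \<subseteq> {..k} - Ss j ! k"
      proof
        fix i assume "i \<in> {i. i \<le> k \<and> w i = w j}"
        then have i: "i \<le> k" "w i = w j" by simp_all
        then show "i \<in> {..k} - Ss j ! k" using kept[OF i(1)] same[OF i(1) that i(2)] by simp
      qed
      then have "card {i. i \<le> k \<and> w i = w j} \<le> card ({..k} - Ss j ! k)" by (intro card_mono) auto
      also have "\<dots> < m" using card_initially_kept assms(3,5) feas that by blast
      finally show ?thesis by simp
    qed
    then obtain j where "j \<le> k" "real (length (w j)) \<ge> 1/2 * log 2 (real k)"
      using long_string_exists k by blast
    then show ?thesis using inst[of j] opt[of j] run[of j] by (intro exI[of _ "?I j"]) blast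
  qed
  \<comment> \<open>Both constants are fixed before the algorithm and the tapes; the threshold
    depends only on \<open>m\<close>.\<close>
  show ?thesis
    by (intro exI[of _ "1/2 :: real"] conjI exI[of _ "4 * m ^ 2 + 1"] allI impI hard) (simp, blast)
qed

end
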